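(* For any Loday pseudoalgebra structure $[\cdot,\cdot]$ on an $\mathcal{A}$-module $\mathcal{E}$ there is a short exact sequence of morphisms of Loday pseudoalgebras over $\mathcal{A}$, $$0\longrightarrow\bar{\mathcal{E}}^0\longrightarrow\mathcal{E}\longrightarrow\bar{\mathcal{E}}\longrightarrow0,$$ where $\bar{\mathcal{E}}^0$, the $\mathcal{A}$-submodule in $\mathcal{E}$ generated by $\{[X,X]:X\in\mathcal{E}\}$, is a Loday pseudoalgebra with the trivial left anchor, and $\bar{\mathcal{E}}=\mathcal{E}/\bar{\mathcal{E}}^0$ is a Lie pseudoalgebra.
   Context: $\mathcal{A}$ is an associative commutative algebra with unity over a field $\mathbb{K}$ of characteristic $0$. Standing assumption: all $\mathcal{A}$-modules are faithful. For a $\mathbb{K}$-bilinear map $B:\mathcal{E}\times\mathcal{E}\to\mathcal{E}$ on an $\mathcal{A}$-module $\mathcal{E}$ and $f\in\mathcal{A}$ put $(\delta_1(f)B)(X,Y)=B(fX,Y)-fB(X,Y)$, $(\delta_2(f)B)(X,Y)=B(X,fY)-fB(X,Y)$. $B$ is a bidifferential operator of total order (degree) $\le1$ if $\delta_i(f)\delta_j(g)B=0$ for all $f,g\in\mathcal{A}$, $i,j\in\{1,2\}$. A $\mathbb{K}$-linear map $D:\mathcal{E}\to\mathcal{E}$ is a derivative endomorphism if for each $f\in\mathcal{A}$ there is $\hat f\in\mathcal{A}$ with $D(fY)-fD(Y)=\hat fY$ for all $Y\in\mathcal{E}$; then $\hat f=\hat D(f)$ for a derivation $\hat D\in\mathrm{Der}(\mathcal{A})$.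 A Loday pseudoalgebra structure on a faithful $\mathcal{A}$-module is a $\mathbb{K}$-bilinear bracket which satisfies $[X,[Y,Z]]=[[X,Y],Z]+[Y,[X,Z]]$, is a bidifferential operator of total order $\le1$, and for which each $\mathrm{ad}_X=[X,\cdot]$ is a derivative endomorphism. Its (left) anchor map is $\rho(X)=\widehat{\mathrm{ad}_X}\in\mathrm{Der}(\mathcal{A})$, so $[X,fY]=f[X,Y]+\rho(X)(f)Y$; it is $\mathcal{A}$-linear in $X$. The left anchor is trivial if $\rho=0$. A Lie pseudoalgebra is a Loday pseudoalgebra whose bracket is a Lie algebra bracket. A morphism of Loday pseudoalgebras over $\mathcal{A}$ is an $\mathcal{A}$-linear map preserving the brackets and intertwining the anchors. The maps in the sequence are the inclusion and the canonical projection; $\bar{\mathcal{E}}^0$ carries the restricted bracket and $\bar{\mathcal{E}}$ the induced one.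
   Formalization: Only E is taken to be faithful; the submodule and the quotient need not be (the submodule is 0 when the bracket is Lie), so their anchors are maps satisfying the anchor rule: zero on the submodule, and on the quotient one intertwined with the anchor of E by the projection. *)

theory Defs
  imports "HOL-Algebra.Module" "HOL-Algebra.QuotRing"
begin

text \<open>
  Throughout, \<open>K\<close> is the ground field, \<open>A\<close> a commutative unital \<open>K\<close>-algebra (locale
  \<^locale>\<open>algebra\<close>) and \<open>E\<close> an \<open>A\<close>-module (locale \<^locale>\<open>module\<close>); all functions matter on carriers
  only.
\<close>

definition char_zero :: "'k ring \<Rightarrow> bool" where
  "char_zero K \<longleftrightarrow> (\<forall>n::nat. n > 0 \<longrightarrow> [n] \<cdot>\<^bsub>K\<^esub> \<one>\<^bsub>K\<^esub> \<noteq> \<zero>\<^bsub>K\<^esub>)"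

definition faithful_module :: "('k, 'a) module \<Rightarrow> ('a, 'e) module \<Rightarrow> bool" where
  "faithful_module A E \<longleftrightarrow>
     (\<forall>f\<in>carrier A. (\<forall>X\<in>carrier E. f \<odot>\<^bsub>E\<^esub> X = \<zero>\<^bsub>E\<^esub>) \<longrightarrow> f = \<zero>\<^bsub>A\<^esub>)"

text \<open>The \<open>K\<close>-vector space structure of an \<open>A\<close>-module, through the structure map \<open>k \<mapsto> k \<cdot> 1\<close> of \<open>A\<close>.\<close>

definition ground_smult :: "('k, 'a) module \<Rightarrow> ('a, 'e) module \<Rightarrow> 'k \<Rightarrow> 'e \<Rightarrow> 'e" where
  "ground_smult A E k X = (k \<odot>\<^bsub>A\<^esub> \<one>\<^bsub>A\<^esub>) \<odot>\<^bsub>E\<^esub> X"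

definition ground_linear ::
  "'k ring \<Rightarrow> ('k, 'a) module \<Rightarrow> ('a, 'e) module \<Rightarrow> ('e \<Rightarrow> 'e) \<Rightarrow> bool" where
  "ground_linear K A E D \<longleftrightarrow>
     D \<in> carrier E \<rightarrow> carrier E \<and>
     (\<forall>X\<in>carrier E. \<forall>Y\<in>carrier E. D (X \<oplus>\<^bsub>E\<^esub> Y) = D X \<oplus>\<^bsub>E\<^esub> D Y) \<and>
     (\<forall>k\<in>carrier K. \<forall>X\<in>carrier E. D (ground_smult A E k X) = ground_smult A E k (D X))"

definition ground_bilinear ::
  "'k ring \<Rightarrow> ('k, 'a) module \<Rightarrow> ('a, 'e) module \<Rightarrow> ('e \<Rightarrow> 'e \<Rightarrow> 'e) \<Rightarrow> bool" where
  "ground_bilinear K A E B \<longleftrightarrow>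
     (\<forall>X\<in>carrier E. ground_linear K A E (\<lambda>Y. B X Y)) \<and>
     (\<forall>Y\<in>carrier E. ground_linear K A E (\<lambda>X. B X Y))"

definition delta1 :: "('a, 'e) module \<Rightarrow> 'a \<Rightarrow> ('e \<Rightarrow> 'e \<Rightarrow> 'e) \<Rightarrow> 'e \<Rightarrow> 'e \<Rightarrow> 'e" where
  "delta1 E f B = (\<lambda>X Y. B (f \<odot>\<^bsub>E\<^esub> X) Y \<ominus>\<^bsub>E\<^esub> f \<odot>\<^bsub>E\<^esub> B X Y)"

definition delta2 :: "('a, 'e) module \<Rightarrow> 'a \<Rightarrow> ('e \<Rightarrow> 'e \<Rightarrow> 'e) \<Rightarrow> 'e \<Rightarrow> 'e \<Rightarrow> 'e" where
  "delta2 E f B = (\<lambda>X Y. B X (f \<odot>\<^bsub>E\<^esub> Y) \<ominus>\<^bsub>E\<^esub> f \<odot>\<^bsub>E\<^esub> B X Y)"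

definition bidiff_op_order1 ::
  "'k ring \<Rightarrow> ('k, 'a) module \<Rightarrow> ('a, 'e) module \<Rightarrow> ('e \<Rightarrow> 'e \<Rightarrow> 'e) \<Rightarrow> bool" where
  "bidiff_op_order1 K A E B \<longleftrightarrow>
     ground_bilinear K A E B \<and>
     (\<forall>di \<in> {delta1 E, delta2 E}. \<forall>dj \<in> {delta1 E, delta2 E}.
        \<forall>f\<in>carrier A. \<forall>g\<in>carrier A. \<forall>X\<in>carrier E. \<forall>Y\<in>carrier E.
          di f (dj g B) X Y = \<zero>\<^bsub>E\<^esub>)"

definition derivative_endomorphism ::
  "'k ring \<Rightarrow> ('k, 'a) module \<Rightarrow> ('a, 'e) module \<Rightarrow> ('e \<Rightarrow> 'e) \<Rightarrow> bool" where
  "derivative_endomorphism K A E D \<longleftrightarrow>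
     ground_linear K A E D \<and>
     (\<forall>f\<in>carrier A. \<exists>g\<in>carrier A. \<forall>Y\<in>carrier E.
        D (f \<odot>\<^bsub>E\<^esub> Y) \<ominus>\<^bsub>E\<^esub> f \<odot>\<^bsub>E\<^esub> D Y = g \<odot>\<^bsub>E\<^esub> Y)"

definition derivation :: "'k ring \<Rightarrow> ('k, 'a) module \<Rightarrow> ('a \<Rightarrow> 'a) \<Rightarrow> bool" where
  "derivation K A d \<longleftrightarrow>
     d \<in> carrier A \<rightarrow> carrier A \<and>
     (\<forall>f\<in>carrier A. \<forall>g\<in>carrier A. d (f \<oplus>\<^bsub>A\<^esub> g) = d f \<oplus>\<^bsub>A\<^esub> d g) \<and>
     (\<forall>k\<in>carrier K. \<forall>f\<in>carrier A. d (k \<odot>\<^bsub>A\<^esub> f) = k \<odot>\<^bsub>A\<^esub> d f) \<and>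
     (\<forall>f\<in>carrier A. \<forall>g\<in>carrier A. d (f \<otimes>\<^bsub>A\<^esub> g) = d f \<otimes>\<^bsub>A\<^esub> g \<oplus>\<^bsub>A\<^esub> f \<otimes>\<^bsub>A\<^esub> d g)"

text \<open>
  Faithfulness of the module is kept as a separate predicate: of the three modules in the exact
  sequence only the middle one is faithful in general (the submodule generated by the squares of a
  Lie bracket is \<open>0\<close>).
\<close>

definition loday_pseudoalgebra ::
  "'k ring \<Rightarrow> ('k, 'a) module \<Rightarrow> ('a, 'e) module \<Rightarrow> ('e \<Rightarrow> 'e \<Rightarrow> 'e) \<Rightarrow> bool" where
  "loday_pseudoalgebra K A E br \<longleftrightarrow>
     module A E \<and>
     ground_bilinear K A E br \<and>
     (\<forall>X\<in>carrier E. \<forall>Y\<in>carrier E. \<forall>Z\<in>carrier E.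
        br X (br Y Z) = br (br X Y) Z \<oplus>\<^bsub>E\<^esub> br Y (br X Z)) \<and>
     bidiff_op_order1 K A E br \<and>
     (\<forall>X\<in>carrier E. derivative_endomorphism K A E (br X))"

definition lie_bracket ::
  "'k ring \<Rightarrow> ('k, 'a) module \<Rightarrow> ('a, 'e) module \<Rightarrow> ('e \<Rightarrow> 'e \<Rightarrow> 'e) \<Rightarrow> bool" where
  "lie_bracket K A E br \<longleftrightarrow>
     ground_bilinear K A E br \<and>
     (\<forall>X\<in>carrier E. br X X = \<zero>\<^bsub>E\<^esub>) \<and>
     (\<forall>X\<in>carrier E. \<forall>Y\<in>carrier E. \<forall>Z\<in>carrier E.
        br X (br Y Z) \<oplus>\<^bsub>E\<^esub> br Y (br Z X) \<oplus>\<^bsub>E\<^esub> br Z (br X Y) = \<zero>\<^bsub>E\<^esub>)"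

definition lie_pseudoalgebra ::
  "'k ring \<Rightarrow> ('k, 'a) module \<Rightarrow> ('a, 'e) module \<Rightarrow> ('e \<Rightarrow> 'e \<Rightarrow> 'e) \<Rightarrow> bool" where
  "lie_pseudoalgebra K A E br \<longleftrightarrow> loday_pseudoalgebra K A E br \<and> lie_bracket K A E br"

text \<open>
  The anchor \<open>\<rho>(X)(f)\<close>; the description is meaningful when \<open>E\<close> is faithful.
\<close>

definition left_anchor ::
  "('k, 'a) module \<Rightarrow> ('a, 'e) module \<Rightarrow> ('e \<Rightarrow> 'e \<Rightarrow> 'e) \<Rightarrow> 'e \<Rightarrow> 'a \<Rightarrow> 'a" where
  "left_anchor A E br X f =
     (THE g. g \<in> carrier A \<and>
        (\<forall>Y\<in>carrier E. br X (f \<odot>\<^bsub>E\<^esub> Y) \<ominus>\<^bsub>E\<^esub> f \<odot>\<^bsub>E\<^esub> br X Y = g \<odot>\<^bsub>E\<^esub> Y))"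

text \<open>
  On a module that is not faithful the anchor is not determined by the bracket, so being an anchor
  is also expressed as a relation. On a faithful module it has at most one solution, namely
  \<^const>\<open>left_anchor\<close>; see \<open>is_left_anchor_unique\<close> below.
\<close>

definition is_left_anchor ::
  "'k ring \<Rightarrow> ('k, 'a) module \<Rightarrow> ('a, 'e) module \<Rightarrow> ('e \<Rightarrow> 'e \<Rightarrow> 'e) \<Rightarrow> ('e \<Rightarrow> 'a \<Rightarrow> 'a) \<Rightarrow> bool"
where
  "is_left_anchor K A E br \<rho> \<longleftrightarrow>
     (\<forall>X\<in>carrier E. derivation K A (\<rho> X)) \<and>
     (\<forall>X\<in>carrier E. \<forall>Y\<in>carrier E. \<forall>f\<in>carrier A. \<rho> (X \<oplus>\<^bsub>E\<^esub> Y) f = \<rho> X f \<oplus>\<^bsub>A\<^esub> \<rho> Y f) \<and>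
     (\<forall>g\<in>carrier A. \<forall>X\<in>carrier E. \<forall>f\<in>carrier A. \<rho> (g \<odot>\<^bsub>E\<^esub> X) f = g \<otimes>\<^bsub>A\<^esub> \<rho> X f) \<and>
     (\<forall>X\<in>carrier E. \<forall>f\<in>carrier A. \<forall>Y\<in>carrier E.
        br X (f \<odot>\<^bsub>E\<^esub> Y) = f \<odot>\<^bsub>E\<^esub> br X Y \<oplus>\<^bsub>E\<^esub> \<rho> X f \<odot>\<^bsub>E\<^esub> Y)"

definition loday_morphism ::
  "('k, 'a) module \<Rightarrow>
   ('a, 'e) module \<Rightarrow> ('e \<Rightarrow> 'e \<Rightarrow> 'e) \<Rightarrow> ('e \<Rightarrow> 'a \<Rightarrow> 'a) \<Rightarrow>
   ('a, 'f) module \<Rightarrow> ('f \<Rightarrow> 'f \<Rightarrow> 'f) \<Rightarrow> ('f \<Rightarrow> 'a \<Rightarrow> 'a) \<Rightarrow> ('e \<Rightarrow> 'f) \<Rightarrow> bool" where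
  "loday_morphism A E br \<rho> F br' \<rho>' \<phi> \<longleftrightarrow>
     \<phi> \<in> carrier E \<rightarrow> carrier F \<and>
     (\<forall>X\<in>carrier E. \<forall>Y\<in>carrier E. \<phi> (X \<oplus>\<^bsub>E\<^esub> Y) = \<phi> X \<oplus>\<^bsub>F\<^esub> \<phi> Y) \<and>
     (\<forall>f\<in>carrier A. \<forall>X\<in>carrier E. \<phi> (f \<odot>\<^bsub>E\<^esub> X) = f \<odot>\<^bsub>F\<^esub> \<phi> X) \<and>
     (\<forall>X\<in>carrier E. \<forall>Y\<in>carrier E. \<phi> (br X Y) = br' (\<phi> X) (\<phi> Y)) \<and>
     (\<forall>X\<in>carrier E. \<forall>f\<in>carrier A. \<rho>' (\<phi> X) f = \<rho> X f)"

definition short_exact ::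
  "('a, 'e) module \<Rightarrow> ('a, 'f) module \<Rightarrow> ('a, 'g) module \<Rightarrow> ('e \<Rightarrow> 'f) \<Rightarrow> ('f \<Rightarrow> 'g) \<Rightarrow> bool" where
  "short_exact E F G \<phi> \<psi> \<longleftrightarrow>
     inj_on \<phi> (carrier E) \<and>
     \<phi> ` carrier E = a_kernel F G \<psi> \<and>
     \<psi> ` carrier F = carrier G"

definition generated_submodule ::
  "('k, 'a) module \<Rightarrow> ('a, 'e) module \<Rightarrow> 'e set \<Rightarrow> 'e set" where
  "generated_submodule A E S = \<Inter> {H. submodule H A E \<and> S \<subseteq> H}"

definition squares_submodule ::
  "('k, 'a) module \<Rightarrow> ('a, 'e) module \<Rightarrow> ('e \<Rightarrow> 'e \<Rightarrow> 'e) \<Rightarrow> 'e set" where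
  "squares_submodule A E br = generated_submodule A E {br X X | X. X \<in> carrier E}"

text \<open>
  Quotient module on the additive cosets of \<open>H\<close>, with operations on cosets in the style of
  \<^const>\<open>rcoset_mult\<close>: the unions collapse to a single coset exactly when the operation descends to
  the quotient. The fields \<open>mult\<close> and \<open>one\<close> of the record play no role for modules.
\<close>

definition quotient_module :: "('a, 'e) module \<Rightarrow> 'e set \<Rightarrow> ('a, 'e set) module" where
  "quotient_module E H =
     \<lparr>carrier = a_rcosets\<^bsub>E\<^esub> H, mult = (\<lambda>_ _. undefined), one = undefined,
      zero = H, add = set_add E, smult = (\<lambda>f C. \<Union>X\<in>C. H +>\<^bsub>E\<^esub> (f \<odot>\<^bsub>E\<^esub> X))\<rparr>"

definition quotient_bracket ::
  "('a, 'e) module \<Rightarrow> 'e set \<Rightarrow> ('e \<Rightarrow> 'e \<Rightarrow> 'e) \<Rightarrow> 'e set \<Rightarrow> 'e set \<Rightarrow> 'e set" where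
  "quotient_bracket E H br C D = (\<Union>X\<in>C. \<Union>Y\<in>D. H +>\<^bsub>E\<^esub> br X Y)"

lemma is_left_anchor_unique:
  assumes E: "module A E" and faithful: "faithful_module A E"
    and br: "ground_bilinear K A E br" and \<rho>: "is_left_anchor K A E br \<rho>"
    and X: "X \<in> carrier E" and f: "f \<in> carrier A"
  shows "left_anchor A E br X f = \<rho> X f"
proof -
  interpret module A E by (rule E)
  have cl: "br X Y \<in> carrier E" if "Y \<in> carrier E" for Y
    using br X that by (auto simp: ground_bilinear_def ground_linear_def)
  have \<rho>A: "\<rho> X f \<in> carrier A"
    using \<rho> X f by (auto simp: is_left_anchor_def derivation_def)
  have eq: "br X (f \<odot>\<^bsub>E\<^esub> Y) \<ominus>\<^bsub>E\<^esub> f \<odot>\<^bsub>E\<^esub> br X Y = \<rho> X f \<odot>\<^bsub>E\<^esub> Y" if Y: "Y \<in> carrier E" for Y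
  proof -
    have "br X (f \<odot>\<^bsub>E\<^esub> Y) = f \<odot>\<^bsub>E\<^esub> br X Y \<oplus>\<^bsub>E\<^esub> \<rho> X f \<odot>\<^bsub>E\<^esub> Y"
      using \<rho> X f Y by (auto simp: is_left_anchor_def)
    also have "\<dots> = \<rho> X f \<odot>\<^bsub>E\<^esub> Y \<oplus>\<^bsub>E\<^esub> f \<odot>\<^bsub>E\<^esub> br X Y"
      using cl[OF Y] f Y \<rho>A by (simp add: M.a_comm)
    finally show ?thesis
      using cl[OF Y] f Y \<rho>A by (simp add: M.minus_eq M.a_assoc M.r_neg)
  qed
  show ?thesis
    unfolding left_anchor_def
  proof (rule the_equality)
    fix g
    assume g: "g \<in> carrier A \<and>
      (\<forall>Y\<in>carrier E. br X (f \<odot>\<^bsub>E\<^esub> Y) \<ominus>\<^bsub>E\<^esub> f \<odot>\<^bsub>E\<^esub> br X Y = g \<odot>\<^bsub>E\<^esub> Y)"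
    have "(g \<ominus>\<^bsub>A\<^esub> \<rho> X f) \<odot>\<^bsub>E\<^esub> Y = \<zero>\<^bsub>E\<^esub>" if Y: "Y \<in> carrier E" for Y
    proof -
      have "g \<odot>\<^bsub>E\<^esub> Y = \<rho> X f \<odot>\<^bsub>E\<^esub> Y" using g eq Y by metis
      then show ?thesis
        using g \<rho>A Y by (simp add: R.minus_eq smult_l_distr smult_l_minus M.r_neg)
    qed
    then have "g \<ominus>\<^bsub>A\<^esub> \<rho> X f = \<zero>\<^bsub>A\<^esub>"
      using faithful g \<rho>A by (auto simp: faithful_module_def)
    then show "g = \<rho> X f"
      using g \<rho>A by (metis R.minus_eq R.minus_equality R.minus_minus R.a_inv_closed R.a_comm)
  qed (use eq \<rho>A in auto)
qed

end

theory Submission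
  imports Defs
begin

text \<open>
  The Leibniz identity with two equal arguments says that \<open>[[X,X],Z] = 0\<close>. Hence the anchor, being
  \<open>A\<close>-linear, vanishes on the submodule \<open>H\<close> generated by the squares. By polarization
  \<open>[X,Y] + [Y,X] \<in> H\<close>, so \<open>[Z,[X,X]] = [[Z,X],X] + [X,[Z,X]]\<close> lies in \<open>H\<close>, and the anchor rule makes
  \<open>H\<close> a left ideal; polarization then makes it a right ideal as well. The bracket and the anchor
  therefore restrict to \<open>H\<close> and descend to \<open>E/H\<close>, where the bracket is alternating.
\<close>

section \<open>Module homomorphisms and transfer of Loday structures\<close>

lemma loday_leibniz:
  assumes "loday_pseudoalgebra K A E br"
    and "X \<in> carrier E" "Y \<in> carrier E" "Z \<in> carrier E"
  shows "br X (br Y Z) = br (br X Y) Z \<oplus>\<^bsub>E\<^esub> br Y (br X Z)"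
  using assms unfolding loday_pseudoalgebra_def by blast

text \<open>Listing the four compositions of \<delta> operators turns the order condition into
  separate equations, each of which can be carried along a module map.\<close>

lemma bidiff_op_order1_iff:
  "bidiff_op_order1 K A E B \<longleftrightarrow>
     ground_bilinear K A E B \<and>
     (\<forall>f\<in>carrier A. \<forall>g\<in>carrier A. \<forall>X\<in>carrier E. \<forall>Y\<in>carrier E.
        delta1 E f (delta1 E g B) X Y = \<zero>\<^bsub>E\<^esub> \<and> delta1 E f (delta2 E g B) X Y = \<zero>\<^bsub>E\<^esub> \<and>
        delta2 E f (delta1 E g B) X Y = \<zero>\<^bsub>E\<^esub> \<and> delta2 E f (delta2 E g B) X Y = \<zero>\<^bsub>E\<^esub>)"
  by (simp add: bidiff_op_order1_def ball_conj_distrib conj_ac)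

section \<open>Linear maps between modules\<close>

locale module_map = E: module A E + F: module A F
  for A :: "('k, 'a) module" and E :: "('a, 'e) module" and F :: "('a, 'f) module" +
  fixes \<phi> :: "'e \<Rightarrow> 'f"
  assumes map_closed: "X \<in> carrier E \<Longrightarrow> \<phi> X \<in> carrier F"
    and map_add: "\<lbrakk>X \<in> carrier E; Y \<in> carrier E\<rbrakk> \<Longrightarrow> \<phi> (X \<oplus>\<^bsub>E\<^esub> Y) = \<phi> X \<oplus>\<^bsub>F\<^esub> \<phi> Y"
    and map_smult: "\<lbrakk>f \<in> carrier A; X \<in> carrier E\<rbrakk> \<Longrightarrow> \<phi> (f \<odot>\<^bsub>E\<^esub> X) = f \<odot>\<^bsub>F\<^esub> \<phi> X"
begin

lemma map_zero: "\<phi> \<zero>\<^bsub>E\<^esub> = \<zero>\<^bsub>F\<^esub>"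
proof -
  have "\<phi> (\<zero>\<^bsub>A\<^esub> \<odot>\<^bsub>E\<^esub> \<zero>\<^bsub>E\<^esub>) = \<zero>\<^bsub>A\<^esub> \<odot>\<^bsub>F\<^esub> \<phi> \<zero>\<^bsub>E\<^esub>"
    by (intro map_smult) auto
  then show ?thesis by (simp add: map_closed)
qed

lemma map_minus:
  assumes X: "X \<in> carrier E" and Y: "Y \<in> carrier E"
  shows "\<phi> (X \<ominus>\<^bsub>E\<^esub> Y) = \<phi> X \<ominus>\<^bsub>F\<^esub> \<phi> Y"
proof -
  have "X \<ominus>\<^bsub>E\<^esub> Y = X \<oplus>\<^bsub>E\<^esub> (\<ominus>\<^bsub>A\<^esub> \<one>\<^bsub>A\<^esub>) \<odot>\<^bsub>E\<^esub> Y"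
    using X Y by (simp add: E.smult_l_minus E.M.minus_eq)
  then have "\<phi> (X \<ominus>\<^bsub>E\<^esub> Y) = \<phi> X \<oplus>\<^bsub>F\<^esub> (\<ominus>\<^bsub>A\<^esub> \<one>\<^bsub>A\<^esub>) \<odot>\<^bsub>F\<^esub> \<phi> Y"
    using X Y by (simp add: map_add map_smult)
  then show ?thesis
    using X Y by (simp add: F.smult_l_minus F.M.minus_eq map_closed)
qed

lemma map_ground_smult:
  assumes "algebra K A" and "k \<in> carrier K" and "X \<in> carrier E"
  shows "\<phi> (ground_smult A E k X) = ground_smult A F k (\<phi> X)"
proof -
  interpret algebra K A by fact
  show ?thesis
    using assms by (simp add: ground_smult_def map_smult)
qed

text \<open>Closure of \<open>B\<close> in \<open>E\<close> is part of the relation, so that the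
  \<delta> operators can be applied repeatedly without leaving the domain of \<phi>.\<close>

definition intertwines :: "('e \<Rightarrow> 'e \<Rightarrow> 'e) \<Rightarrow> ('f \<Rightarrow> 'f \<Rightarrow> 'f) \<Rightarrow> bool" where
  "intertwines B B' \<longleftrightarrow>
     (\<forall>X\<in>carrier E. \<forall>Y\<in>carrier E. B X Y \<in> carrier E \<and> \<phi> (B X Y) = B' (\<phi> X) (\<phi> Y))"

lemma intertwines_delta1:
  assumes "intertwines B B'" and "f \<in> carrier A"
  shows "intertwines (delta1 E f B) (delta1 F f B')"
  using assms by (simp add: intertwines_def delta1_def map_minus map_smult)

lemma intertwines_delta2:
  assumes "intertwines B B'" and "f \<in> carrier A"
  shows "intertwines (delta2 E f B) (delta2 F f B')"
  using assms by (simp add: intertwines_def delta2_def map_minus map_smult)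

text \<open>The \<delta> operators use only \<open>B\<close>, scalar multiplication and subtraction,
  all respected by \<phi>. The four cases match those of
  \<open>bidiff_op_order1_iff\<close>.\<close>

lemma intertwines_delta:
  assumes B: "intertwines B B'" and f: "f \<in> carrier A" and g: "g \<in> carrier A"
  shows "intertwines (delta1 E f (delta1 E g B)) (delta1 F f (delta1 F g B'))"
    and "intertwines (delta1 E f (delta2 E g B)) (delta1 F f (delta2 F g B'))"
    and "intertwines (delta2 E f (delta1 E g B)) (delta2 F f (delta1 F g B'))"
    and "intertwines (delta2 E f (delta2 E g B)) (delta2 F f (delta2 F g B'))"
  by (intro intertwines_delta1 intertwines_delta2 B f g)+

section \<open>Transfer along surjective and injective maps\<close>

lemma ground_linear_surj:
  assumes alg: "algebra K A" and surj: "\<phi> ` carrier E = carrier F"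
    and D: "ground_linear K A E D" and D': "\<And>X. X \<in> carrier E \<Longrightarrow> \<phi> (D X) = D' (\<phi> X)"
  shows "ground_linear K A F D'"
proof -
  interpret algebra K A by fact
  have cl: "D X \<in> carrier E" if "X \<in> carrier E" for X
    using D that by (auto simp: ground_linear_def)
  have gs: "ground_smult A E k X \<in> carrier E" if "k \<in> carrier K" "X \<in> carrier E" for k X
    using that by (simp add: ground_smult_def)
  show ?thesis
    \<comment> \<open>With the carrier of \<open>F\<close> written as an image,
      \<open>clarify\<close> replaces each element of it by some \<open>\<phi> X\<close>, and every
      identity becomes the image of one in \<open>E\<close>.\<close>
    unfolding ground_linear_def surj[symmetric]
  proof (intro conjI ballI funcsetI; clarify)
    fix X assume X: "X \<in> carrier E"
    then show "D' (\<phi> X) \<in> \<phi> ` carrier E"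
      by (metis D' cl imageI)
    show "D' (\<phi> X \<oplus>\<^bsub>F\<^esub> \<phi> Y) = D' (\<phi> X) \<oplus>\<^bsub>F\<^esub> D' (\<phi> Y)" if Y: "Y \<in> carrier E" for Y
      using D X Y by (simp add: ground_linear_def cl flip: map_add D')
    show "D' (ground_smult A F k (\<phi> X)) = ground_smult A F k (D' (\<phi> X))"
      if k: "k \<in> carrier K" for k
      using D X k by (simp add: ground_linear_def cl gs flip: map_ground_smult[OF alg] D')
  qed
qed

text \<open>Both sides of each identity agree after applying \<phi>, which can then be cancelled.
  That \<open>D\<close> stays in \<open>E\<close> is a premise, since \<open>D'\<close> need not
  preserve the image of \<phi>.\<close>

lemma ground_linear_inj:
  assumes alg: "algebra K A" and inj: "inj_on \<phi> (carrier E)"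
    and D': "ground_linear K A F D'" and cl: "\<And>X. X \<in> carrier E \<Longrightarrow> D X \<in> carrier E"
    and D: "\<And>X. X \<in> carrier E \<Longrightarrow> \<phi> (D X) = D' (\<phi> X)"
  shows "ground_linear K A E D"
proof -
  interpret algebra K A by fact
  have gs: "ground_smult A E k X \<in> carrier E" if "k \<in> carrier K" "X \<in> carrier E" for k X
    using that by (simp add: ground_smult_def)
  show ?thesis
    unfolding ground_linear_def
  proof (intro conjI ballI funcsetI)
    fix X assume X: "X \<in> carrier E"
    then show "D X \<in> carrier E" by (rule cl)
    show "D (X \<oplus>\<^bsub>E\<^esub> Y) = D X \<oplus>\<^bsub>E\<^esub> D Y" if Y: "Y \<in> carrier E" for Y
      using D' X Y by (intro inj_onD[OF inj]) (simp_all add: ground_linear_def cl map_add D map_closed)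
  next
    fix k X assume k: "k \<in> carrier K" and X: "X \<in> carrier E"
    then show "D (ground_smult A E k X) = ground_smult A E k (D X)"
      using D' by (intro inj_onD[OF inj])
        (simp_all add: ground_linear_def cl gs map_ground_smult[OF alg] D map_closed)
  qed
qed

text \<open>This serves the projection onto the quotient. All axioms except the last are linear
  identities pushed through \<phi>; in the derivative condition the same witness \<open>g\<close>
  serves \<open>F\<close>, because \<phi> is \<open>A\<close>-linear.\<close>

lemma loday_pseudoalgebra_surj:
  assumes alg: "algebra K A" and surj: "\<phi> ` carrier E = carrier F"
    and loday: "loday_pseudoalgebra K A E br" and br': "intertwines br br'"
  shows "loday_pseudoalgebra K A F br'"
proof -
  have br: "br X Y \<in> carrier E" "\<phi> (br X Y) = br' (\<phi> X) (\<phi> Y)"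
    if "X \<in> carrier E" "Y \<in> carrier E" for X Y
    using br' that by (auto simp: intertwines_def)
  note transfer = ground_linear_surj[OF alg surj]
  have linear: "ground_linear K A E (br X)" "ground_linear K A E (\<lambda>Y. br Y X)"
    if "X \<in> carrier E" for X
    using loday that by (auto simp: loday_pseudoalgebra_def ground_bilinear_def)
  have linear': "ground_linear K A F (br' (\<phi> X))" if "X \<in> carrier E" for X
    using that by (intro transfer[OF linear(1)[OF that]]) (simp add: br)
  have bilinear: "ground_bilinear K A F br'"
    unfolding ground_bilinear_def surj[symmetric]
  proof (intro conjI ballI; clarify)
    fix X assume X: "X \<in> carrier E"
    show "ground_linear K A F (br' (\<phi> X))"
      by (rule linear'[OF X])
    show "ground_linear K A F (\<lambda>Y. br' Y (\<phi> X))"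
      using X by (intro transfer[OF linear(2)[OF X]]) (simp add: br)
  qed
  have leibniz: "br' (\<phi> X) (br' (\<phi> Y) (\<phi> Z)) =
      br' (br' (\<phi> X) (\<phi> Y)) (\<phi> Z) \<oplus>\<^bsub>F\<^esub> br' (\<phi> Y) (br' (\<phi> X) (\<phi> Z))"
    if X: "X \<in> carrier E" and Y: "Y \<in> carrier E" and Z: "Z \<in> carrier E" for X Y Z
  proof -
    have "\<phi> (br X (br Y Z)) = \<phi> (br (br X Y) Z \<oplus>\<^bsub>E\<^esub> br Y (br X Z))"
      using loday_leibniz[OF loday X Y Z] by simp
    then show ?thesis using X Y Z by (simp add: br map_add)
  qed
  \<comment> \<open>To be used with \<open>B\<close> and \<open>B'\<close> two-fold \<delta>
    operators of \<open>br\<close> and \<open>br'\<close>.\<close>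
  have push: "B' (\<phi> X) (\<phi> Y) = \<zero>\<^bsub>F\<^esub>"
    if "intertwines B B'" "B X Y = \<zero>\<^bsub>E\<^esub>" "X \<in> carrier E" "Y \<in> carrier E" for B B' X Y
    using that by (metis intertwines_def map_zero)
  have bidiff: "bidiff_op_order1 K A F br'"
    unfolding bidiff_op_order1_iff surj[symmetric]
  proof (intro conjI bilinear ballI; clarify)
    fix f g X Y
    assume f: "f \<in> carrier A" and g: "g \<in> carrier A"
      and X: "X \<in> carrier E" and Y: "Y \<in> carrier E"
    have zero: "delta1 E f (delta1 E g br) X Y = \<zero>\<^bsub>E\<^esub>" "delta1 E f (delta2 E g br) X Y = \<zero>\<^bsub>E\<^esub>"
      "delta2 E f (delta1 E g br) X Y = \<zero>\<^bsub>E\<^esub>" "delta2 E f (delta2 E g br) X Y = \<zero>\<^bsub>E\<^esub>"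
      using loday f g X Y by (simp_all add: loday_pseudoalgebra_def bidiff_op_order1_iff)
    note intertwines = intertwines_delta[OF br' f g]
    show "delta1 F f (delta1 F g br') (\<phi> X) (\<phi> Y) = \<zero>\<^bsub>F\<^esub>"
      by (rule push[OF intertwines(1) zero(1) X Y])
    show "delta1 F f (delta2 F g br') (\<phi> X) (\<phi> Y) = \<zero>\<^bsub>F\<^esub>"
      by (rule push[OF intertwines(2) zero(2) X Y])
    show "delta2 F f (delta1 F g br') (\<phi> X) (\<phi> Y) = \<zero>\<^bsub>F\<^esub>"
      by (rule push[OF intertwines(3) zero(3) X Y])
    show "delta2 F f (delta2 F g br') (\<phi> X) (\<phi> Y) = \<zero>\<^bsub>F\<^esub>"
      by (rule push[OF intertwines(4) zero(4) X Y])
  qed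
  have derivative: "derivative_endomorphism K A F (br' (\<phi> X))" if X: "X \<in> carrier E" for X
    unfolding derivative_endomorphism_def
  proof (intro conjI linear' X ballI)
    fix f assume f: "f \<in> carrier A"
    obtain g where g: "g \<in> carrier A"
      "\<forall>Y\<in>carrier E. br X (f \<odot>\<^bsub>E\<^esub> Y) \<ominus>\<^bsub>E\<^esub> f \<odot>\<^bsub>E\<^esub> br X Y = g \<odot>\<^bsub>E\<^esub> Y"
      using loday X f unfolding loday_pseudoalgebra_def derivative_endomorphism_def by blast
    have "br' (\<phi> X) (f \<odot>\<^bsub>F\<^esub> \<phi> Y) \<ominus>\<^bsub>F\<^esub> f \<odot>\<^bsub>F\<^esub> br' (\<phi> X) (\<phi> Y) = g \<odot>\<^bsub>F\<^esub> \<phi> Y"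
      if Y: "Y \<in> carrier E" for Y
    proof -
      have "\<phi> (br X (f \<odot>\<^bsub>E\<^esub> Y) \<ominus>\<^bsub>E\<^esub> f \<odot>\<^bsub>E\<^esub> br X Y) = \<phi> (g \<odot>\<^bsub>E\<^esub> Y)"
        using g Y by simp
      then show ?thesis using X Y f g(1) by (simp add: br map_minus map_smult)
    qed
    then show "\<exists>g\<in>carrier A. \<forall>Y\<in>carrier F.
        br' (\<phi> X) (f \<odot>\<^bsub>F\<^esub> Y) \<ominus>\<^bsub>F\<^esub> f \<odot>\<^bsub>F\<^esub> br' (\<phi> X) Y = g \<odot>\<^bsub>F\<^esub> Y"
      unfolding surj[symmetric] using g(1) by blast
  qed
  show ?thesis
    unfolding loday_pseudoalgebra_def surj[symmetric]
  proof (intro conjI F.module_axioms bilinear bidiff ballI; clarify)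
    fix X assume X: "X \<in> carrier E"
    then show "derivative_endomorphism K A F (br' (\<phi> X))" by (rule derivative)
    fix Y Z assume "Y \<in> carrier E" "Z \<in> carrier E"
    with X show "br' (\<phi> X) (br' (\<phi> Y) (\<phi> Z)) =
        br' (br' (\<phi> X) (\<phi> Y)) (\<phi> Z) \<oplus>\<^bsub>F\<^esub> br' (\<phi> Y) (br' (\<phi> X) (\<phi> Z))"
      by (rule leibniz)
  qed
qed

text \<open>This serves the inclusion of the squares submodule. Every axiom holds in
  \<open>F\<close> at the images and is pulled back by injectivity, the witness \<open>g\<close>
  again being unchanged.\<close>

lemma loday_pseudoalgebra_inj:
  assumes alg: "algebra K A" and inj: "inj_on \<phi> (carrier E)"
    and loday: "loday_pseudoalgebra K A F br'" and br': "intertwines br br'"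
  shows "loday_pseudoalgebra K A E br"
proof -
  have br: "br X Y \<in> carrier E" "\<phi> (br X Y) = br' (\<phi> X) (\<phi> Y)"
    if "X \<in> carrier E" "Y \<in> carrier E" for X Y
    using br' that by (auto simp: intertwines_def)
  note transfer = ground_linear_inj[OF alg inj]
  have linear': "ground_linear K A F (br' X)" "ground_linear K A F (\<lambda>Y. br' Y X)"
    if "X \<in> carrier F" for X
    using loday that by (auto simp: loday_pseudoalgebra_def ground_bilinear_def)
  have linear: "ground_linear K A E (br X)" if X: "X \<in> carrier E" for X
    using X by (intro transfer[OF linear'(1)[OF map_closed[OF X]]]) (simp_all add: br)
  have bilinear: "ground_bilinear K A E br"
    unfolding ground_bilinear_def
  proof (intro conjI ballI)
    fix X assume X: "X \<in> carrier E"
    show "ground_linear K A E (br X)"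
      by (rule linear[OF X])
    show "ground_linear K A E (\<lambda>Y. br Y X)"
      using X by (intro transfer[OF linear'(2)[OF map_closed[OF X]]]) (simp_all add: br)
  qed
  have leibniz: "br X (br Y Z) = br (br X Y) Z \<oplus>\<^bsub>E\<^esub> br Y (br X Z)"
    if X: "X \<in> carrier E" and Y: "Y \<in> carrier E" and Z: "Z \<in> carrier E" for X Y Z
    using loday_leibniz[OF loday map_closed[OF X] map_closed[OF Y] map_closed[OF Z]] X Y Z
    by (intro inj_onD[OF inj]) (simp_all add: br map_add)
  have pull: "B X Y = \<zero>\<^bsub>E\<^esub>"
    if "intertwines B B'" "B' (\<phi> X) (\<phi> Y) = \<zero>\<^bsub>F\<^esub>" "X \<in> carrier E" "Y \<in> carrier E" for B B' X Y
    using that by (intro inj_onD[OF inj]) (simp_all add: intertwines_def map_zero)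
  have bidiff: "bidiff_op_order1 K A E br"
    unfolding bidiff_op_order1_iff
  proof (intro conjI bilinear ballI)
    fix f g X Y
    assume f: "f \<in> carrier A" and g: "g \<in> carrier A"
      and X: "X \<in> carrier E" and Y: "Y \<in> carrier E"
    have zero: "delta1 F f (delta1 F g br') (\<phi> X) (\<phi> Y) = \<zero>\<^bsub>F\<^esub>"
      "delta1 F f (delta2 F g br') (\<phi> X) (\<phi> Y) = \<zero>\<^bsub>F\<^esub>"
      "delta2 F f (delta1 F g br') (\<phi> X) (\<phi> Y) = \<zero>\<^bsub>F\<^esub>"
      "delta2 F f (delta2 F g br') (\<phi> X) (\<phi> Y) = \<zero>\<^bsub>F\<^esub>"
      using loday f g map_closed[OF X] map_closed[OF Y]
      by (simp_all add: loday_pseudoalgebra_def bidiff_op_order1_iff)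
    note intertwines = intertwines_delta[OF br' f g]
    show "delta1 E f (delta1 E g br) X Y = \<zero>\<^bsub>E\<^esub>"
      by (rule pull[OF intertwines(1) zero(1) X Y])
    show "delta1 E f (delta2 E g br) X Y = \<zero>\<^bsub>E\<^esub>"
      by (rule pull[OF intertwines(2) zero(2) X Y])
    show "delta2 E f (delta1 E g br) X Y = \<zero>\<^bsub>E\<^esub>"
      by (rule pull[OF intertwines(3) zero(3) X Y])
    show "delta2 E f (delta2 E g br) X Y = \<zero>\<^bsub>E\<^esub>"
      by (rule pull[OF intertwines(4) zero(4) X Y])
  qed
  have derivative: "derivative_endomorphism K A E (br X)" if X: "X \<in> carrier E" for X
    unfolding derivative_endomorphism_def
  proof (intro conjI linear X ballI)
    fix f assume f: "f \<in> carrier A"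
    obtain g where g: "g \<in> carrier A"
      "\<forall>Y\<in>carrier F. br' (\<phi> X) (f \<odot>\<^bsub>F\<^esub> Y) \<ominus>\<^bsub>F\<^esub> f \<odot>\<^bsub>F\<^esub> br' (\<phi> X) Y = g \<odot>\<^bsub>F\<^esub> Y"
      using loday map_closed[OF X] f
      unfolding loday_pseudoalgebra_def derivative_endomorphism_def by blast
    have "br X (f \<odot>\<^bsub>E\<^esub> Y) \<ominus>\<^bsub>E\<^esub> f \<odot>\<^bsub>E\<^esub> br X Y = g \<odot>\<^bsub>E\<^esub> Y" if Y: "Y \<in> carrier E" for Y
      using g X Y f
      by (intro inj_onD[OF inj]) (simp_all add: br map_minus map_smult map_closed)
    then show "\<exists>g\<in>carrier A. \<forall>Y\<in>carrier E.
        br X (f \<odot>\<^bsub>E\<^esub> Y) \<ominus>\<^bsub>E\<^esub> f \<odot>\<^bsub>E\<^esub> br X Y = g \<odot>\<^bsub>E\<^esub> Y"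
      using g(1) by blast
  qed
  show ?thesis
    unfolding loday_pseudoalgebra_def
    using E.module_axioms bilinear bidiff leibniz derivative by blast
qed

text \<open>The anchor rule is pushed through \<phi>. Agreement of \<open>\<rho>' (\<phi> X)\<close>
  with \<open>\<rho> X\<close> is equality of functions on the whole type, so that the derivation
  property transfers by rewriting.\<close>

lemma is_left_anchor_surj:
  assumes surj: "\<phi> ` carrier E = carrier F" and br': "intertwines br br'"
    and \<rho>: "is_left_anchor K A E br \<rho>" and \<rho>': "\<And>X. X \<in> carrier E \<Longrightarrow> \<rho>' (\<phi> X) = \<rho> X"
  shows "is_left_anchor K A F br' \<rho>'"
proof -
  have br: "br X Y \<in> carrier E" "br' (\<phi> X) (\<phi> Y) = \<phi> (br X Y)"
    if "X \<in> carrier E" "Y \<in> carrier E" for X Y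
    using br' that by (auto simp: intertwines_def)
  have \<rho>A: "\<rho> X f \<in> carrier A" if "X \<in> carrier E" "f \<in> carrier A" for X f
    using \<rho> that by (auto simp: is_left_anchor_def derivation_def)
  show ?thesis
    unfolding is_left_anchor_def surj[symmetric]
  proof (intro conjI ballI; clarify)
    fix X assume X: "X \<in> carrier E"
    show "derivation K A (\<rho>' (\<phi> X))"
      using \<rho> X by (simp add: is_left_anchor_def \<rho>')
    fix f assume f: "f \<in> carrier A"
    show "\<rho>' (\<phi> X \<oplus>\<^bsub>F\<^esub> \<phi> Y) f = \<rho>' (\<phi> X) f \<oplus>\<^bsub>A\<^esub> \<rho>' (\<phi> Y) f" if Y: "Y \<in> carrier E" for Y
      using \<rho> X Y f by (simp add: is_left_anchor_def \<rho>' flip: map_add)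
    show "\<rho>' (g \<odot>\<^bsub>F\<^esub> \<phi> X) f = g \<otimes>\<^bsub>A\<^esub> \<rho>' (\<phi> X) f" if g: "g \<in> carrier A" for g
      using \<rho> X g f by (simp add: is_left_anchor_def \<rho>' flip: map_smult)
    show "br' (\<phi> X) (f \<odot>\<^bsub>F\<^esub> \<phi> Y) = f \<odot>\<^bsub>F\<^esub> br' (\<phi> X) (\<phi> Y) \<oplus>\<^bsub>F\<^esub> \<rho>' (\<phi> X) f \<odot>\<^bsub>F\<^esub> \<phi> Y"
      if Y: "Y \<in> carrier E" for Y
      using \<rho> X Y f by (simp add: is_left_anchor_def \<rho>' br \<rho>A flip: map_smult map_add)
  qed
qed

end

section \<open>Quotient modules\<close>

locale module_quotient = module A E
  for A :: "('k, 'a) module" and E :: "('a, 'e) module" +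
  fixes H :: "'e set"
  assumes sub: "submodule H A E"
begin

sublocale sub: abelian_subgroup H E
  by (intro abelian_subgroupI3 additive_subgroupI submodule.axioms(1)[OF sub] M.abelian_group_axioms)

lemma smult_sub_closed: "\<lbrakk>f \<in> carrier A; X \<in> H\<rbrakk> \<Longrightarrow> f \<odot>\<^bsub>E\<^esub> X \<in> H"
  using submodule.smult_closed[OF sub] .

lemma coset_eqI:
  assumes "X \<in> carrier E" and "h \<in> H"
  shows "H +>\<^bsub>E\<^esub> (h \<oplus>\<^bsub>E\<^esub> X) = H +>\<^bsub>E\<^esub> X"
proof -
  have "h \<oplus>\<^bsub>E\<^esub> X \<in> H +>\<^bsub>E\<^esub> X" using assms by (auto simp: a_r_coset_def')
  then show ?thesis
    using M.a_repr_independence[OF _ assms(1) sub.a_subgroup] by simp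
qed

lemma coset_elemE:
  assumes "Y \<in> H +>\<^bsub>E\<^esub> X" and "X \<in> carrier E"
  obtains h where "h \<in> H" "Y = h \<oplus>\<^bsub>E\<^esub> X"
  using assms by (auto simp: a_r_coset_def')

text \<open>Since \<open>H\<close> is the zero of the quotient, this converts vanishing there into
  membership in \<open>H\<close>; the kernel, the alternating law and the Jacobi identity all go
  through it.\<close>

lemma coset_eq_sub_iff:
  assumes X: "X \<in> carrier E"
  shows "H +>\<^bsub>E\<^esub> X = H \<longleftrightarrow> X \<in> H"
  using X sub.a_rcos_self[OF X] M.a_coset_join2[OF X sub.a_subgroup] by auto

lemma quotient_smult_coset:
  assumes f: "f \<in> carrier A" and X: "X \<in> carrier E"
  shows "f \<odot>\<^bsub>quotient_module E H\<^esub> (H +>\<^bsub>E\<^esub> X) = H +>\<^bsub>E\<^esub> (f \<odot>\<^bsub>E\<^esub> X)"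
proof -
  have "H +>\<^bsub>E\<^esub> (f \<odot>\<^bsub>E\<^esub> Y) = H +>\<^bsub>E\<^esub> (f \<odot>\<^bsub>E\<^esub> X)" if "Y \<in> H +>\<^bsub>E\<^esub> X" for Y
    using that X
  proof (rule coset_elemE)
    fix h assume h: "h \<in> H" "Y = h \<oplus>\<^bsub>E\<^esub> X"
    have "f \<odot>\<^bsub>E\<^esub> Y = f \<odot>\<^bsub>E\<^esub> h \<oplus>\<^bsub>E\<^esub> f \<odot>\<^bsub>E\<^esub> X"
      using h f X by (simp add: smult_r_distr)
    then show ?thesis
      using h f X by (simp add: coset_eqI smult_sub_closed)
  qed
  \<comment> \<open>A union of a constant family collapses to its value once the index set is
    nonempty, and \<open>X\<close> lies in its own coset.\<close>
  then have "(\<Union>Y\<in>H +>\<^bsub>E\<^esub> X. H +>\<^bsub>E\<^esub> (f \<odot>\<^bsub>E\<^esub> Y)) = H +>\<^bsub>E\<^esub> (f \<odot>\<^bsub>E\<^esub> X)"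
    using sub.a_rcos_self[OF X] by blast
  then show ?thesis by (simp add: quotient_module_def)
qed

lemma quotient_add_coset:
  assumes "X \<in> carrier E" and "Y \<in> carrier E"
  shows "(H +>\<^bsub>E\<^esub> X) \<oplus>\<^bsub>quotient_module E H\<^esub> (H +>\<^bsub>E\<^esub> Y) = H +>\<^bsub>E\<^esub> (X \<oplus>\<^bsub>E\<^esub> Y)"
  using assms by (simp add: quotient_module_def sub.a_rcos_sum)

lemma carrier_quotient: "carrier (quotient_module E H) = (\<lambda>X. H +>\<^bsub>E\<^esub> X) ` carrier E"
  by (auto simp: quotient_module_def A_RCOSETS_def')

lemma abelian_group_quotient: "abelian_group (quotient_module E H)"
proof (rule abelian_groupI)
  \<comment> \<open>Writing the zero \<open>H\<close> as the coset of \<open>\<zero>\<close> makes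
    the coset addition rule applicable to it.\<close>
  have zero: "\<zero>\<^bsub>quotient_module E H\<^esub> = H +>\<^bsub>E\<^esub> \<zero>\<^bsub>E\<^esub>"
    by (simp add: quotient_module_def sub.a_subset)
  show "\<zero>\<^bsub>quotient_module E H\<^esub> \<in> carrier (quotient_module E H)"
    by (auto simp: zero carrier_quotient)
  fix C assume "C \<in> carrier (quotient_module E H)"
  then obtain X where X: "X \<in> carrier E" "C = H +>\<^bsub>E\<^esub> X"
    by (auto simp: carrier_quotient)
  then show "\<zero>\<^bsub>quotient_module E H\<^esub> \<oplus>\<^bsub>quotient_module E H\<^esub> C = C"
    by (simp add: zero quotient_add_coset)
  have "(H +>\<^bsub>E\<^esub> (\<ominus>\<^bsub>E\<^esub> X)) \<oplus>\<^bsub>quotient_module E H\<^esub> C = \<zero>\<^bsub>quotient_module E H\<^esub>"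
    using X by (simp add: zero quotient_add_coset M.l_neg)
  then show "\<exists>D\<in>carrier (quotient_module E H).
      D \<oplus>\<^bsub>quotient_module E H\<^esub> C = \<zero>\<^bsub>quotient_module E H\<^esub>"
    using X by (auto simp: carrier_quotient)
qed (auto simp: carrier_quotient quotient_add_coset M.a_ac)

lemma module_quotient: "module A (quotient_module E H)"
  by (rule moduleI)
    (auto simp: carrier_quotient quotient_smult_coset quotient_add_coset smult_l_distr
      smult_r_distr smult_assoc1 intro: R.is_cring abelian_group_quotient)

lemma module_map_projection: "module_map A E (quotient_module E H) (\<lambda>X. H +>\<^bsub>E\<^esub> X)"
  by (intro module_map.intro module_map_axioms.intro module_axioms module_quotient)
    (auto simp: carrier_quotient quotient_smult_coset quotient_add_coset)

lemma module_map_inclusion: "module_map A (E\<lparr>carrier := H\<rparr>) E (\<lambda>X. X)"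
  by (intro module_map.intro module_map_axioms.intro module_axioms
      submodule.submodule_is_module[OF sub]) auto

text \<open>Exactness in the middle is \<open>coset_eq_sub_iff\<close>; the two ends are immediate
  from the identity map and from the form of the quotient carrier.\<close>

lemma short_exact_quotient:
  "short_exact (E\<lparr>carrier := H\<rparr>) E (quotient_module E H) (\<lambda>X. X) (\<lambda>X. H +>\<^bsub>E\<^esub> X)"
  using coset_eq_sub_iff sub.a_subset
  by (auto simp: short_exact_def a_kernel_def' carrier_quotient) (auto simp: quotient_module_def)

text \<open>Changing representatives alters the bracket only by elements of the two-sided ideal
  \<open>H\<close>, so the defining union collapses to one coset.\<close>

lemma quotient_bracket_coset:
  assumes cl: "\<And>X Y. \<lbrakk>X \<in> carrier E; Y \<in> carrier E\<rbrakk> \<Longrightarrow> br X Y \<in> carrier E"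
    and add_l: "\<And>X Y Z. \<lbrakk>X \<in> carrier E; Y \<in> carrier E; Z \<in> carrier E\<rbrakk>
      \<Longrightarrow> br (X \<oplus>\<^bsub>E\<^esub> Y) Z = br X Z \<oplus>\<^bsub>E\<^esub> br Y Z"
    and add_r: "\<And>X Y Z. \<lbrakk>X \<in> carrier E; Y \<in> carrier E; Z \<in> carrier E\<rbrakk>
      \<Longrightarrow> br X (Y \<oplus>\<^bsub>E\<^esub> Z) = br X Y \<oplus>\<^bsub>E\<^esub> br X Z"
    and ideal_l: "\<And>X Y. \<lbrakk>X \<in> carrier E; Y \<in> H\<rbrakk> \<Longrightarrow> br X Y \<in> H"
    and ideal_r: "\<And>X Y. \<lbrakk>X \<in> H; Y \<in> carrier E\<rbrakk> \<Longrightarrow> br X Y \<in> H"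
    and X: "X \<in> carrier E" and Y: "Y \<in> carrier E"
  shows "quotient_bracket E H br (H +>\<^bsub>E\<^esub> X) (H +>\<^bsub>E\<^esub> Y) = H +>\<^bsub>E\<^esub> br X Y"
proof -
  have "H +>\<^bsub>E\<^esub> br X' Y' = H +>\<^bsub>E\<^esub> br X Y"
    if X': "X' \<in> H +>\<^bsub>E\<^esub> X" and Y': "Y' \<in> H +>\<^bsub>E\<^esub> Y" for X' Y'
  proof -
    obtain h where h: "h \<in> H" "X' = h \<oplus>\<^bsub>E\<^esub> X" using X' X by (rule coset_elemE)
    obtain k where k: "k \<in> H" "Y' = k \<oplus>\<^bsub>E\<^esub> Y" using Y' Y by (rule coset_elemE)
    have [simp]: "h \<in> carrier E" "k \<in> carrier E" using h k by auto
    \<comment> \<open>Only the left argument is split in the first term: \<open>br h Y'\<close> lies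
      in \<open>H\<close> whatever \<open>Y'\<close> is, and \<open>br X k\<close> lies in
      \<open>H\<close> by the other ideal property.\<close>
    have "br X' Y' = br h Y' \<oplus>\<^bsub>E\<^esub> (br X k \<oplus>\<^bsub>E\<^esub> br X Y)"
      using h k X Y by (simp add: add_l add_r cl M.a_ac)
    then show ?thesis
      using h k X Y by (simp add: coset_eqI ideal_l ideal_r cl)
  qed
  then show ?thesis
    unfolding quotient_bracket_def
    using sub.a_rcos_self[OF X] sub.a_rcos_self[OF Y] by blast
qed

end

section \<open>The anchor and the submodule of squares\<close>

locale faithful_loday = module A E
  for K :: "'k ring" and A :: "('k, 'a) module" and E :: "('a, 'e) module" +
  fixes br :: "'e \<Rightarrow> 'e \<Rightarrow> 'e"
  assumes algebra: "algebra K A"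
    and faithful: "faithful_module A E"
    and loday: "loday_pseudoalgebra K A E br"
begin

abbreviation "\<rho> \<equiv> left_anchor A E br"

abbreviation "H \<equiv> squares_submodule A E br"

section \<open>Elementary rules for the bracket and the anchor\<close>

lemma br_closed [simp, intro]: "\<lbrakk>X \<in> carrier E; Y \<in> carrier E\<rbrakk> \<Longrightarrow> br X Y \<in> carrier E"
  using loday by (auto simp: loday_pseudoalgebra_def ground_bilinear_def ground_linear_def)

lemma br_add_left: "\<lbrakk>X \<in> carrier E; Y \<in> carrier E; Z \<in> carrier E\<rbrakk>
    \<Longrightarrow> br (X \<oplus>\<^bsub>E\<^esub> Y) Z = br X Z \<oplus>\<^bsub>E\<^esub> br Y Z"
  using loday by (simp add: loday_pseudoalgebra_def ground_bilinear_def ground_linear_def)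

lemma br_add_right: "\<lbrakk>X \<in> carrier E; Y \<in> carrier E; Z \<in> carrier E\<rbrakk>
    \<Longrightarrow> br X (Y \<oplus>\<^bsub>E\<^esub> Z) = br X Y \<oplus>\<^bsub>E\<^esub> br X Z"
  using loday by (simp add: loday_pseudoalgebra_def ground_bilinear_def ground_linear_def)

lemma br_ground_smult_right: "\<lbrakk>k \<in> carrier K; X \<in> carrier E; Y \<in> carrier E\<rbrakk>
    \<Longrightarrow> br X ((k \<odot>\<^bsub>A\<^esub> \<one>\<^bsub>A\<^esub>) \<odot>\<^bsub>E\<^esub> Y) = (k \<odot>\<^bsub>A\<^esub> \<one>\<^bsub>A\<^esub>) \<odot>\<^bsub>E\<^esub> br X Y"
  using loday
  by (simp add: loday_pseudoalgebra_def ground_bilinear_def ground_linear_def ground_smult_def)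

lemmas leibniz = loday_leibniz[OF loday]

lemma minus_eq_iff: "\<lbrakk>X \<in> carrier E; Y \<in> carrier E; Z \<in> carrier E\<rbrakk>
    \<Longrightarrow> X \<ominus>\<^bsub>E\<^esub> Y = Z \<longleftrightarrow> X = Y \<oplus>\<^bsub>E\<^esub> Z"
  by (metis M.a_comm M.add.inv_solve_right' M.minus_eq)

text \<open>Faithfulness applied to the difference \<open>f - g\<close>. It reduces identities
  between elements of \<open>A\<close> to identities in \<open>E\<close>.\<close>

lemma faithful_eqI:
  assumes f: "f \<in> carrier A" and g: "g \<in> carrier A"
    and eq: "\<And>Y. Y \<in> carrier E \<Longrightarrow> f \<odot>\<^bsub>E\<^esub> Y = g \<odot>\<^bsub>E\<^esub> Y"
  shows "f = g"
proof -
  have "(f \<ominus>\<^bsub>A\<^esub> g) \<odot>\<^bsub>E\<^esub> Y = \<zero>\<^bsub>E\<^esub>" if "Y \<in> carrier E" for Y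
    using f g eq that by (simp add: R.minus_eq smult_l_distr smult_l_minus M.r_neg)
  then have "f \<ominus>\<^bsub>A\<^esub> g = \<zero>\<^bsub>A\<^esub>"
    using faithful f g by (auto simp: faithful_module_def)
  then show ?thesis
    using f g by (metis R.minus_eq R.minus_equality R.minus_minus R.a_inv_closed R.a_comm)
qed

text \<open>The definite description is legitimate: existence comes from the derivative endomorphism
  axiom, uniqueness from faithfulness.\<close>

lemma anchor_props:
  assumes X: "X \<in> carrier E" and f: "f \<in> carrier A"
  shows "\<rho> X f \<in> carrier A \<and> (\<forall>Y\<in>carrier E. br X (f \<odot>\<^bsub>E\<^esub> Y) \<ominus>\<^bsub>E\<^esub> f \<odot>\<^bsub>E\<^esub> br X Y = \<rho> X f \<odot>\<^bsub>E\<^esub> Y)"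
  unfolding left_anchor_def
proof (rule theI')
  obtain g where "g \<in> carrier A"
    "\<forall>Y\<in>carrier E. br X (f \<odot>\<^bsub>E\<^esub> Y) \<ominus>\<^bsub>E\<^esub> f \<odot>\<^bsub>E\<^esub> br X Y = g \<odot>\<^bsub>E\<^esub> Y"
    using loday X f unfolding loday_pseudoalgebra_def derivative_endomorphism_def by blast
  then show "\<exists>!g. g \<in> carrier A \<and>
      (\<forall>Y\<in>carrier E. br X (f \<odot>\<^bsub>E\<^esub> Y) \<ominus>\<^bsub>E\<^esub> f \<odot>\<^bsub>E\<^esub> br X Y = g \<odot>\<^bsub>E\<^esub> Y)"
    using faithful_eqI by (intro ex1I[of _ g]) auto
qed

lemma anchor_closed [simp]: "\<lbrakk>X \<in> carrier E; f \<in> carrier A\<rbrakk> \<Longrightarrow> \<rho> X f \<in> carrier A"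
  using anchor_props by blast

lemma br_minus_smult:
  "\<lbrakk>X \<in> carrier E; f \<in> carrier A; Y \<in> carrier E\<rbrakk>
    \<Longrightarrow> br X (f \<odot>\<^bsub>E\<^esub> Y) \<ominus>\<^bsub>E\<^esub> f \<odot>\<^bsub>E\<^esub> br X Y = \<rho> X f \<odot>\<^bsub>E\<^esub> Y"
  using anchor_props by blast

lemma br_smult_right:
  "\<lbrakk>X \<in> carrier E; f \<in> carrier A; Y \<in> carrier E\<rbrakk>
    \<Longrightarrow> br X (f \<odot>\<^bsub>E\<^esub> Y) = f \<odot>\<^bsub>E\<^esub> br X Y \<oplus>\<^bsub>E\<^esub> \<rho> X f \<odot>\<^bsub>E\<^esub> Y"
  using br_minus_smult[of X f Y] by (simp add: minus_eq_iff)

text \<open>The anchor rule characterizes the anchor, so computing \<open>br X (f \<odot> Y)\<close>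
  in another way identifies \<open>\<rho> X f\<close>.\<close>

lemma anchor_eqI:
  assumes X: "X \<in> carrier E" and f: "f \<in> carrier A" and g: "g \<in> carrier A"
    and eq: "\<And>Y. Y \<in> carrier E \<Longrightarrow> br X (f \<odot>\<^bsub>E\<^esub> Y) = f \<odot>\<^bsub>E\<^esub> br X Y \<oplus>\<^bsub>E\<^esub> g \<odot>\<^bsub>E\<^esub> Y"
  shows "\<rho> X f = g"
proof (rule faithful_eqI)
  fix Y assume Y: "Y \<in> carrier E"
  show "\<rho> X f \<odot>\<^bsub>E\<^esub> Y = g \<odot>\<^bsub>E\<^esub> Y"
    using eq[OF Y] br_smult_right[OF X f Y] X f g Y by simp
qed (use X f g in auto)

lemma derivation_anchor:
  assumes X: "X \<in> carrier E"
  shows "derivation K A (\<rho> X)"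
proof -
  interpret KA: algebra K A by (rule algebra)
  show ?thesis
    unfolding derivation_def
  proof (intro conjI ballI funcsetI)
    fix f assume f: "f \<in> carrier A"
    then show "\<rho> X f \<in> carrier A" using X by simp
    fix g assume g: "g \<in> carrier A"
    show "\<rho> X (f \<oplus>\<^bsub>A\<^esub> g) = \<rho> X f \<oplus>\<^bsub>A\<^esub> \<rho> X g"
      using X f g
      by (intro anchor_eqI)
        (simp_all add: smult_l_distr br_add_right br_smult_right M.a_ac)
    \<comment> \<open>The product acts as \<open>f\<close> after \<open>g\<close>, so the anchor
      rule is applied twice to the bracket of \<open>X\<close> with
      \<open>f \<odot> (g \<odot> Y)\<close>.\<close>
    show "\<rho> X (f \<otimes>\<^bsub>A\<^esub> g) = \<rho> X f \<otimes>\<^bsub>A\<^esub> g \<oplus>\<^bsub>A\<^esub> f \<otimes>\<^bsub>A\<^esub> \<rho> X g"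
      using X f g
      by (intro anchor_eqI)
        (simp_all add: smult_assoc1 smult_l_distr smult_r_distr br_smult_right M.a_ac)
  next
    fix k f assume k: "k \<in> carrier K" and f: "f \<in> carrier A"
    \<comment> \<open>A scalar of \<open>K\<close> acts as multiplication by
      \<open>k \<odot> 1\<close>, which ground linearity pulls out of the bracket. The rule is used
      only at \<open>f\<close> and \<open>\<rho> X f\<close>, because in general form it also
      matches \<open>k \<odot> 1\<close> itself.\<close>
    have smult: "k \<odot>\<^bsub>A\<^esub> g = (k \<odot>\<^bsub>A\<^esub> \<one>\<^bsub>A\<^esub>) \<otimes>\<^bsub>A\<^esub> g" if "g \<in> carrier A" for g
      using k that by (simp add: KA.smult_assoc2)
    show "\<rho> X (k \<odot>\<^bsub>A\<^esub> f) = k \<odot>\<^bsub>A\<^esub> \<rho> X f"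
      using X f k
      by (intro anchor_eqI)
        (simp_all add: smult[of f] smult[of "\<rho> X f"] smult_assoc1 smult_r_distr br_ground_smult_right
          br_smult_right[of X f])
  qed
qed

text \<open>This is where \<open>\<delta>\<^sub>1(g) \<delta>\<^sub>2(f) [\<cdot>,\<cdot>] = 0\<close> enters.\<close>

lemma anchor_smult:
  assumes X: "X \<in> carrier E" and f: "f \<in> carrier A" and g: "g \<in> carrier A"
  shows "\<rho> (g \<odot>\<^bsub>E\<^esub> X) f = g \<otimes>\<^bsub>A\<^esub> \<rho> X f"
proof (rule faithful_eqI)
  fix Y assume Y: "Y \<in> carrier E"
  have "delta1 E g (delta2 E f br) X Y = \<zero>\<^bsub>E\<^esub>"
    using loday X Y f g by (simp add: loday_pseudoalgebra_def bidiff_op_order1_def)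
  \<comment> \<open>The operator \<delta>2 with \<open>f\<close> turns the bracket into
    \<open>\<rho> X f \<odot> Y\<close>, so \<delta>1 with \<open>g\<close> measures its failure to
    be \<open>A\<close>-linear in \<open>X\<close>.\<close>
  then have "\<rho> (g \<odot>\<^bsub>E\<^esub> X) f \<odot>\<^bsub>E\<^esub> Y \<ominus>\<^bsub>E\<^esub> g \<odot>\<^bsub>E\<^esub> (\<rho> X f \<odot>\<^bsub>E\<^esub> Y) = \<zero>\<^bsub>E\<^esub>"
    using X Y f g by (simp add: delta1_def delta2_def br_minus_smult)
  then show "\<rho> (g \<odot>\<^bsub>E\<^esub> X) f \<odot>\<^bsub>E\<^esub> Y = (g \<otimes>\<^bsub>A\<^esub> \<rho> X f) \<odot>\<^bsub>E\<^esub> Y"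
    using X Y f g by (simp add: minus_eq_iff smult_assoc1)
qed (use X f g in auto)

text \<open>Additivity splits the left argument first. The anchor rule is instantiated at
  \<open>X\<close> and \<open>Y\<close> so that it cannot fire on their sum, whose anchor is being
  determined.\<close>

lemma anchor_add:
  assumes "X \<in> carrier E" and "Y \<in> carrier E" and "f \<in> carrier A"
  shows "\<rho> (X \<oplus>\<^bsub>E\<^esub> Y) f = \<rho> X f \<oplus>\<^bsub>A\<^esub> \<rho> Y f"
  using assms
  by (intro anchor_eqI)
    (simp_all add: br_add_left br_smult_right[of X] br_smult_right[of Y] smult_l_distr smult_r_distr M.a_ac)

lemma is_left_anchor_anchor: "is_left_anchor K A E br \<rho>"
  by (simp add: is_left_anchor_def derivation_anchor anchor_add anchor_smult br_smult_right)

section \<open>The submodule generated by the squares\<close>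

lemma submodule_squares: "submodule H A E"
proof -
  define \<S> where "\<S> = {S. submodule S A E \<and> {br X X |X. X \<in> carrier E} \<subseteq> S}"
  have \<S>: "submodule S A E" if "S \<in> \<S>" for S
    using that by (simp add: \<S>_def)
  have "submodule (\<Inter> \<S>) A E"
  proof (rule submoduleI)
    \<comment> \<open>The family is nonempty; an empty intersection would be the whole type.\<close>
    have "carrier E \<in> \<S>" using carrier_is_submodule by (auto simp: \<S>_def)
    then show "\<Inter> \<S> \<subseteq> carrier E" by (rule Inter_lower)
    show "\<zero>\<^bsub>E\<^esub> \<in> \<Inter> \<S>"
      using subgroup.one_closed[OF submodule.axioms(1)[OF \<S>]] by simp
    show "\<ominus>\<^bsub>E\<^esub> X \<in> \<Inter> \<S>" if "X \<in> \<Inter> \<S>" for X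
      using that submoduleE(3)[OF \<S>] by blast
    show "X \<oplus>\<^bsub>E\<^esub> Y \<in> \<Inter> \<S>" if "X \<in> \<Inter> \<S>" "Y \<in> \<Inter> \<S>" for X Y
      using that submoduleE(5)[OF \<S>] by blast
    show "f \<odot>\<^bsub>E\<^esub> X \<in> \<Inter> \<S>" if "f \<in> carrier A" "X \<in> \<Inter> \<S>" for f X
      using that submoduleE(4)[OF \<S>] by blast
  qed
  then show ?thesis
    by (simp add: squares_submodule_def generated_submodule_def \<S>_def)
qed

lemma square_in_squares: "X \<in> carrier E \<Longrightarrow> br X X \<in> H"
  by (auto simp: squares_submodule_def generated_submodule_def)

text \<open>Induction principle for \<open>H\<close>: a property that holds for squares and cuts out
  a submodule holds throughout \<open>H\<close>.\<close>

lemma squares_subset: "submodule S A E \<Longrightarrow> (\<And>X. X \<in> carrier E \<Longrightarrow> br X X \<in> S) \<Longrightarrow> H \<subseteq> S"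
  by (auto simp: squares_submodule_def generated_submodule_def)

sublocale Q: module_quotient A E H
  by (intro module_quotient.intro module_quotient_axioms.intro module_axioms submodule_squares)

lemma square_br_zero:
  assumes X: "X \<in> carrier E" and Z: "Z \<in> carrier E"
  shows "br (br X X) Z = \<zero>\<^bsub>E\<^esub>"
  using leibniz[OF X X Z] X Z by simp

text \<open>For fixed \<open>f\<close> the zeros of the anchor form a submodule by
  \<open>A\<close>-linearity. It contains the squares because bracketing with a square on the left
  is zero, which satisfies the anchor rule with coefficient zero.\<close>

lemma anchor_squares_zero:
  assumes h: "h \<in> H" and f: "f \<in> carrier A"
  shows "\<rho> h f = \<zero>\<^bsub>A\<^esub>"
proof -
  have zero: "\<rho> \<zero>\<^bsub>E\<^esub> f = \<zero>\<^bsub>A\<^esub>"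
    using anchor_smult[of "\<zero>\<^bsub>E\<^esub>" f "\<zero>\<^bsub>A\<^esub>"] f by simp
  have "H \<subseteq> {X \<in> carrier E. \<rho> X f = \<zero>\<^bsub>A\<^esub>}"
  proof (rule squares_subset)
    show "submodule {X \<in> carrier E. \<rho> X f = \<zero>\<^bsub>A\<^esub>} A E"
    proof (rule submoduleI)
      fix X assume "X \<in> {X \<in> carrier E. \<rho> X f = \<zero>\<^bsub>A\<^esub>}"
      then have X: "X \<in> carrier E" "\<rho> X f = \<zero>\<^bsub>A\<^esub>" by auto
      then have "\<ominus>\<^bsub>E\<^esub> X = (\<ominus>\<^bsub>A\<^esub> \<one>\<^bsub>A\<^esub>) \<odot>\<^bsub>E\<^esub> X" by (simp add: smult_l_minus)
      then show "\<ominus>\<^bsub>E\<^esub> X \<in> {X \<in> carrier E. \<rho> X f = \<zero>\<^bsub>A\<^esub>}"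
        using X f anchor_smult[of X f "\<ominus>\<^bsub>A\<^esub> \<one>\<^bsub>A\<^esub>"] by simp
    qed (use f zero in \<open>auto simp: anchor_add anchor_smult\<close>)
    fix X assume X: "X \<in> carrier E"
    have "\<rho> (br X X) f = \<zero>\<^bsub>A\<^esub>"
      using X f by (intro anchor_eqI) (simp_all add: square_br_zero)
    then show "br X X \<in> {X \<in> carrier E. \<rho> X f = \<zero>\<^bsub>A\<^esub>}" using X by simp
  qed
  then show ?thesis using h by blast
qed

text \<open>Expanding the square of \<open>X \<oplus> Y\<close> expresses the symmetrized bracket
  through three squares.\<close>

lemma br_polarization:
  assumes X: "X \<in> carrier E" and Y: "Y \<in> carrier E"
  shows "br X Y \<oplus>\<^bsub>E\<^esub> br Y X \<in> H"
proof -
  have "br (X \<oplus>\<^bsub>E\<^esub> Y) (X \<oplus>\<^bsub>E\<^esub> Y) = br X X \<oplus>\<^bsub>E\<^esub> br Y Y \<oplus>\<^bsub>E\<^esub> (br X Y \<oplus>\<^bsub>E\<^esub> br Y X)"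
    using X Y by (simp add: br_add_left br_add_right M.a_ac)
  then have "br X Y \<oplus>\<^bsub>E\<^esub> br Y X =
      \<ominus>\<^bsub>E\<^esub> (br X X \<oplus>\<^bsub>E\<^esub> br Y Y) \<oplus>\<^bsub>E\<^esub> br (X \<oplus>\<^bsub>E\<^esub> Y) (X \<oplus>\<^bsub>E\<^esub> Y)"
    using X Y by (simp add: M.r_neg1)
  moreover have "\<dots> \<in> H"
    using X Y by (intro Q.sub.a_closed Q.sub.a_inv_closed square_in_squares) auto
  ultimately show ?thesis by simp
qed

lemma br_squares_right:
  assumes Z: "Z \<in> carrier E" and h: "h \<in> H"
  shows "br Z h \<in> H"
proof -
  \<comment> \<open>Membership in \<open>H\<close> is kept in the induction set: the anchor rule for
    \<open>br Z (f \<odot> X)\<close> leaves the term \<open>\<rho> Z f \<odot> X\<close>, which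
    lies in \<open>H\<close> because \<open>X\<close> does.\<close>
  have "H \<subseteq> {X \<in> H. br Z X \<in> H}"
  proof (rule squares_subset)
    show "submodule {X \<in> H. br Z X \<in> H} A E"
    proof (rule submoduleI)
      have "br Z \<zero>\<^bsub>E\<^esub> = \<zero>\<^bsub>E\<^esub>"
        using br_add_right[of Z "\<zero>\<^bsub>E\<^esub>" "\<zero>\<^bsub>E\<^esub>"] Z by simp
      then show "\<zero>\<^bsub>E\<^esub> \<in> {X \<in> H. br Z X \<in> H}" by simp
      show smult: "f \<odot>\<^bsub>E\<^esub> X \<in> {X \<in> H. br Z X \<in> H}"
        if "f \<in> carrier A" "X \<in> {X \<in> H. br Z X \<in> H}" for f X
        using that Z by (simp add: br_smult_right Q.smult_sub_closed)
      show "\<ominus>\<^bsub>E\<^esub> X \<in> {X \<in> H. br Z X \<in> H}" if "X \<in> {X \<in> H. br Z X \<in> H}" for X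
        using smult[of "\<ominus>\<^bsub>A\<^esub> \<one>\<^bsub>A\<^esub>", OF _ that] that by (simp add: smult_l_minus)
    qed (use Z in \<open>auto simp: br_add_right\<close>)
    fix X assume X: "X \<in> carrier E"
    have "br Z (br X X) = br (br Z X) X \<oplus>\<^bsub>E\<^esub> br X (br Z X)"
      using X Z by (intro leibniz)
    also have "\<dots> \<in> H" using X Z by (intro br_polarization) auto
    finally show "br X X \<in> {X \<in> H. br Z X \<in> H}"
      using X by (simp add: square_in_squares)
  qed
  then show ?thesis using h by blast
qed

lemma br_squares_left:
  assumes Z: "Z \<in> carrier E" and h: "h \<in> H"
  shows "br h Z \<in> H"
proof -
  have h': "h \<in> carrier E" using h by simp
  have "br h Z = \<ominus>\<^bsub>E\<^esub> br Z h \<oplus>\<^bsub>E\<^esub> (br Z h \<oplus>\<^bsub>E\<^esub> br h Z)"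
    using h' Z by (simp add: M.r_neg1)
  also have "\<dots> \<in> H"
    using h h' Z by (intro Q.sub.a_closed Q.sub.a_inv_closed br_squares_right br_polarization)
  finally show ?thesis .
qed

section \<open>The restricted and the induced bracket\<close>

sublocale incl: module_map A "E\<lparr>carrier := H\<rparr>" E "\<lambda>X. X"
  by (rule Q.module_map_inclusion)

sublocale proj: module_map A E "quotient_module E H" "\<lambda>X. H +>\<^bsub>E\<^esub> X"
  by (rule Q.module_map_projection)

lemma quotient_br:
  "\<lbrakk>X \<in> carrier E; Y \<in> carrier E\<rbrakk>
    \<Longrightarrow> quotient_bracket E H br (H +>\<^bsub>E\<^esub> X) (H +>\<^bsub>E\<^esub> Y) = H +>\<^bsub>E\<^esub> br X Y"
  by (intro Q.quotient_bracket_coset br_closed br_add_left br_add_right br_squares_left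
      br_squares_right)

lemma loday_squares: "loday_pseudoalgebra K A (E\<lparr>carrier := H\<rparr>) br"
  by (rule incl.loday_pseudoalgebra_inj[OF algebra _ loday])
    (auto simp: incl.intertwines_def br_squares_right)

text \<open>The anchor of \<open>E\<close> vanishes on \<open>H\<close>, so its rule there reads as
  \<open>A\<close>-linearity of the bracket in the right argument. The relational form is used
  because \<open>H\<close> may fail to be faithful.\<close>

lemma is_left_anchor_squares: "is_left_anchor K A (E\<lparr>carrier := H\<rparr>) br (\<lambda>X f. \<zero>\<^bsub>A\<^esub>)"
proof -
  interpret KA: algebra K A by (rule algebra)
  show ?thesis
    by (auto simp: is_left_anchor_def derivation_def br_smult_right anchor_squares_zero)
qed

lemma intertwines_projection: "proj.intertwines br (quotient_bracket E H br)"
  by (auto simp: proj.intertwines_def quotient_br)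

lemma projection_surj: "(\<lambda>X. H +>\<^bsub>E\<^esub> X) ` carrier E = carrier (quotient_module E H)"
  by (simp add: Q.carrier_quotient)

lemma loday_quotient: "loday_pseudoalgebra K A (quotient_module E H) (quotient_bracket E H br)"
  by (rule proj.loday_pseudoalgebra_surj[OF algebra projection_surj loday intertwines_projection])

lemma lie_quotient: "lie_pseudoalgebra K A (quotient_module E H) (quotient_bracket E H br)"
proof -
  have zero: "\<zero>\<^bsub>quotient_module E H\<^esub> = H" by (simp add: quotient_module_def)
  have jacobi: "br X (br Y Z) \<oplus>\<^bsub>E\<^esub> br Y (br Z X) \<oplus>\<^bsub>E\<^esub> br Z (br X Y) \<in> H"
    if X: "X \<in> carrier E" and Y: "Y \<in> carrier E" and Z: "Z \<in> carrier E" for X Y Z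
  proof -
    \<comment> \<open>The Leibniz identity rewrites the first term. Regrouping gives a symmetrized
      bracket of \<open>br X Y\<close> and \<open>Z\<close>, plus the bracket of \<open>Y\<close>
      with a symmetrized bracket; both lie in \<open>H\<close>.\<close>
    have "br X (br Y Z) \<oplus>\<^bsub>E\<^esub> br Y (br Z X) \<oplus>\<^bsub>E\<^esub> br Z (br X Y) =
        (br (br X Y) Z \<oplus>\<^bsub>E\<^esub> br Z (br X Y)) \<oplus>\<^bsub>E\<^esub> br Y (br X Z \<oplus>\<^bsub>E\<^esub> br Z X)"
      using X Y Z by (simp add: leibniz[of X Y Z] br_add_right M.a_ac)
    also have "\<dots> \<in> H"
      using X Y Z by (intro Q.sub.a_closed br_squares_right br_polarization) auto
    finally show ?thesis .
  qed
  have bilinear: "ground_bilinear K A (quotient_module E H) (quotient_bracket E H br)"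
    using loday_quotient by (simp add: loday_pseudoalgebra_def)
  have "lie_bracket K A (quotient_module E H) (quotient_bracket E H br)"
    unfolding lie_bracket_def projection_surj[symmetric] zero
  proof (intro conjI bilinear ballI; clarify)
    fix X assume X: "X \<in> carrier E"
    then show "quotient_bracket E H br (H +>\<^bsub>E\<^esub> X) (H +>\<^bsub>E\<^esub> X) = H"
      by (simp add: quotient_br Q.coset_eq_sub_iff square_in_squares)
    fix Y Z assume "Y \<in> carrier E" "Z \<in> carrier E"
    with X show "quotient_bracket E H br (H +>\<^bsub>E\<^esub> X)
          (quotient_bracket E H br (H +>\<^bsub>E\<^esub> Y) (H +>\<^bsub>E\<^esub> Z)) \<oplus>\<^bsub>quotient_module E H\<^esub>
        quotient_bracket E H br (H +>\<^bsub>E\<^esub> Y)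
          (quotient_bracket E H br (H +>\<^bsub>E\<^esub> Z) (H +>\<^bsub>E\<^esub> X)) \<oplus>\<^bsub>quotient_module E H\<^esub>
        quotient_bracket E H br (H +>\<^bsub>E\<^esub> Z)
          (quotient_bracket E H br (H +>\<^bsub>E\<^esub> X) (H +>\<^bsub>E\<^esub> Y)) = H"
      by (simp add: quotient_br Q.quotient_add_coset Q.coset_eq_sub_iff jacobi)
  qed
  then show ?thesis
    by (simp add: lie_pseudoalgebra_def loday_quotient)
qed

text \<open>Compatibility with the anchors is exactly the vanishing of \<rho> on
  \<open>H\<close>.\<close>

lemma loday_morphism_inclusion:
  "loday_morphism A (E\<lparr>carrier := H\<rparr>) br (\<lambda>X f. \<zero>\<^bsub>A\<^esub>) E br \<rho> (\<lambda>X. X)"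
  by (auto simp: loday_morphism_def anchor_squares_zero)

text \<open>On a quotient that is not faithful the bracket does not determine an anchor, so one is
  constructed by letting \<rho> descend to cosets.\<close>

lemma quotient_anchor:
  "\<exists>\<rho>Q. is_left_anchor K A (quotient_module E H) (quotient_bracket E H br) \<rho>Q \<and>
     loday_morphism A E br \<rho> (quotient_module E H) (quotient_bracket E H br) \<rho>Q (\<lambda>X. H +>\<^bsub>E\<^esub> X)"
proof -
  \<comment> \<open>Off the carrier of \<open>A\<close> the anchor of \<open>E\<close> need not be constant on cosets, so it is cut off there.\<close>
  define \<rho>c where "\<rho>c X f = (if f \<in> carrier A then \<rho> X f else undefined)" for X f
  define \<rho>Q where "\<rho>Q C = \<rho>c (SOME X. X \<in> C)" for C
  have anchor_c: "is_left_anchor K A E br \<rho>c"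
  proof -
    interpret KA: algebra K A by (rule algebra)
    show ?thesis
      using is_left_anchor_anchor by (auto simp: is_left_anchor_def derivation_def \<rho>c_def)
  qed
  \<comment> \<open>The chosen representative is \<open>h \<oplus> X\<close> with \<open>h\<close>
    in \<open>H\<close>. On the carrier of \<open>A\<close> additivity and vanishing on
    \<open>H\<close> remove \<open>h\<close>; elsewhere both sides are
    \<open>undefined\<close>.\<close>
  have \<rho>Q: "\<rho>Q (H +>\<^bsub>E\<^esub> X) = \<rho>c X" if X: "X \<in> carrier E" for X
  proof -
    have "(SOME Y. Y \<in> H +>\<^bsub>E\<^esub> X) \<in> H +>\<^bsub>E\<^esub> X"
      using Q.sub.a_rcos_self[OF X] by (rule someI)
    then obtain h where h: "h \<in> H" "(SOME Y. Y \<in> H +>\<^bsub>E\<^esub> X) = h \<oplus>\<^bsub>E\<^esub> X"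
      using X by (rule Q.coset_elemE)
    then show ?thesis
      using X by (auto simp: \<rho>Q_def \<rho>c_def anchor_add anchor_squares_zero)
  qed
  have "is_left_anchor K A (quotient_module E H) (quotient_bracket E H br) \<rho>Q"
    by (rule proj.is_left_anchor_surj[OF projection_surj intertwines_projection anchor_c \<rho>Q])
  moreover have
    "loday_morphism A E br \<rho> (quotient_module E H) (quotient_bracket E H br) \<rho>Q (\<lambda>X. H +>\<^bsub>E\<^esub> X)"
    by (auto simp: loday_morphism_def proj.map_closed proj.map_add proj.map_smult quotient_br
        \<rho>Q \<rho>c_def)
  ultimately show ?thesis by blast
qed

end

theorem theorem6p5:
  fixes K :: "'k ring" and A :: "('k, 'a) module" and E :: "('a, 'e) module"
    and br :: "'e \<Rightarrow> 'e \<Rightarrow> 'e"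
  assumes "field K" and "char_zero K" and "algebra K A"
    and "faithful_module A E"
    and "loday_pseudoalgebra K A E br"
  shows "let H = squares_submodule A E br;
             E0 = E\<lparr>carrier := H\<rparr>;
             Q = quotient_module E H;
             brQ = quotient_bracket E H br;
             \<rho> = left_anchor A E br;
             \<rho>0 = (\<lambda>X f. \<zero>\<^bsub>A\<^esub>);
             \<iota> = (\<lambda>X. X);
             \<pi> = (\<lambda>X. H +>\<^bsub>E\<^esub> X)
         in is_left_anchor K A E br \<rho> \<and>
            submodule H A E \<and>
            loday_pseudoalgebra K A E0 br \<and> is_left_anchor K A E0 br \<rho>0 \<and>
            lie_pseudoalgebra K A Q brQ \<and>
            loday_morphism A E0 br \<rho>0 E br \<rho> \<iota> \<and>
            (\<exists>\<rho>Q. is_left_anchor K A Q brQ \<rho>Q \<and> loday_morphism A E br \<rho> Q brQ \<rho>Q \<pi>) \<and>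
            short_exact E0 E Q \<iota> \<pi>"
proof -
  have "module A E"
    using assms(5) unfolding loday_pseudoalgebra_def by (rule conjunct1)
  then interpret faithful_loday K A E br
    by (intro faithful_loday.intro faithful_loday_axioms.intro assms(3-5))
  show ?thesis
    unfolding Let_def
    using is_left_anchor_anchor submodule_squares loday_squares is_left_anchor_squares
      lie_quotient loday_morphism_inclusion quotient_anchor Q.short_exact_quotient
    by (intro conjI)
qed

end
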